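(* Let $a,b,c,d,e,a',b',c',e'$ be complex parameters with $$a'=d-a,\qquad e'=d+e-a-b-c,$$ and suppose that $$\Re(d+e-a-b-c)>0,\qquad \Re(d+e'-a'-b'-c')>0,\qquad \Re(a')>0.$$ Then $$F_{1:1}^{0:3}\left[{-\atop d}:{a,b,c\atop e};{a',b',c'\atop e'};1,1\right]=\frac{\Gamma(d)\,\Gamma(e')\,\Gamma(d+e'-a'-b'-c')}{\Gamma(a')\,\Gamma(d+e'-a'-b')\,\Gamma(d+e'-a'-c')}\;{}_4F_3\left[{a,\;e-b,\;e-c,\;d+e'-a'-b'-c'\atop e,\;d+e'-a'-b',\;d+e'-a'-c'};1\right].$$
   Context: $(x)_m=x(x+1)\cdots(x+m-1)$, $(x)_0=1$, is the Pochhammer symbol, and $(x_1,\dots,x_r)_m=(x_1)_m\cdots(x_r)_m$. The Kampé de Fériet series is $$F_{1:1}^{0:3}\left[{-\atop d}:{a,b,c\atop e};{a',b',c'\atop e'};x,y\right]=\sum_{m,n=0}^\infty\frac{(a,b,c)_m(a',b',c')_n}{(d)_{m+n}(e)_m(e')_n}\frac{x^my^n}{m!\,n!}.$$ It is absolutely convergent for $|x|=|y|=1$ when $\Re(d+e-a-b-c)>0$ and $\Re(d+e'-a'-b'-c')>0$. The generalized hypergeometric series is ${}_{p}F_{q}\left[{\alpha_1,\dots,\alpha_p\atop\beta_1,\dots,\beta_q};x\right]=\sum_{k\ge0}\frac{(\alpha_1,\dots,\alpha_p)_k}{(\beta_1,\dots,\beta_q)_k}\frac{x^k}{k!}$. It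 is understood throughout that no denominator parameter of any series occurring (the single or the double one) is zero or a negative integer. *)

theory Defs
  imports "HOL-Analysis.Analysis"
begin

definition pFq :: "complex list \<Rightarrow> complex list \<Rightarrow> complex \<Rightarrow> complex" where
  "pFq as bs x = eval_fps (fps_hypergeo as bs 1) x"

lemma pFq_altdef:
  "pFq as bs x =
     (\<Sum>k. (\<Prod>a\<leftarrow>as. pochhammer a k) / (\<Prod>b\<leftarrow>bs. pochhammer b k) * (x ^ k / fact k))"
proof -
  have *: "foldl (\<lambda>r a. r * pochhammer a k) v xs = v * (\<Prod>a\<leftarrow>xs. pochhammer a k)"
    for v :: complex and xs k
    by (induction xs arbitrary: v) (simp_all add: mult.assoc)
  show ?thesis
    by (simp add: pFq_def eval_fps_def *)
qed

definition kampe_de_feriet_term ::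
  "complex \<Rightarrow> complex \<Rightarrow> complex \<Rightarrow> complex \<Rightarrow> complex \<Rightarrow>
   complex \<Rightarrow> complex \<Rightarrow> complex \<Rightarrow> complex \<Rightarrow> complex \<Rightarrow> complex \<Rightarrow> nat \<Rightarrow> nat \<Rightarrow> complex"
where
  "kampe_de_feriet_term d a b c e a' b' c' e' x y m n =
     (pochhammer a m * pochhammer b m * pochhammer c m *
      (pochhammer a' n * pochhammer b' n * pochhammer c' n)) /
     (pochhammer d (m + n) * pochhammer e m * pochhammer e' n) *
     (x ^ m * y ^ n / (fact m * fact n))"

text \<open>
  The double series with parameter scheme \<open>[- ; d : a, b, c ; e : a', b', c' ; e']\<close>. The
  unordered sum over all pairs is the value of the series wherever it converges absolutely.
\<close>

definition kampe_de_feriet ::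
  "complex \<Rightarrow> complex \<Rightarrow> complex \<Rightarrow> complex \<Rightarrow> complex \<Rightarrow>
   complex \<Rightarrow> complex \<Rightarrow> complex \<Rightarrow> complex \<Rightarrow> complex \<Rightarrow> complex \<Rightarrow> complex"
where
  "kampe_de_feriet d a b c e a' b' c' e' x y =
     (\<Sum>\<^sub>\<infinity>(m, n)\<in>UNIV. kampe_de_feriet_term d a b c e a' b' c' e' x y m n)"

end

theory Submission
  imports Defs "HOL-Real_Asymp.Real_Asymp"
begin

text \<open>
  Write \<open>1 / (d)\<^sub>m\<^sub>+\<^sub>n = \<Gamma>(d) / \<Gamma>(d + m + n)\<close> and sum over \<open>m\<close> first. For fixed \<open>n\<close> the inner sum is a series
  \<open>\<^sub>3F\<^sub>2(a, b, c; d + n, e; 1)\<close>, and Thomae's transformation turns it into a multiple of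
  \<open>\<^sub>3F\<^sub>2(a, e - b, e - c; \<sigma> + n, e; 1)\<close> with \<open>\<sigma> = d + e - b - c = d + e' - a'\<close>. The relations
  \<open>a' = d - a\<close> and \<open>e' = d + e - a - b - c\<close> are exactly what makes the Gamma factors produced by the
  transformation cancel the parameters \<open>a'\<close> and \<open>e'\<close> of the sum over \<open>n\<close>. The remaining double series depends on
  \<open>n\<close> only through \<open>(b')\<^sub>n (c')\<^sub>n / (n! \<Gamma>(\<sigma> + k + n))\<close>; after a second interchange the sum over \<open>n\<close> is given by
  Gauss's theorem, and the sum over \<open>k\<close> that is left is the \<open>\<^sub>4F\<^sub>3\<close>.

  Both interchanges rest on absolute convergence. The growth bounds for \<open>(z)\<^sub>n\<close> and \<open>1/\<Gamma>(z + n)\<close>, and the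
  criterion \<open>summable_on_double_rGamma\<close> derived from them, apply before and after the transformation;
  for the double series after the transformation its hypothesis on the first index reads \<open>Re a' > 0\<close>.

  Euler's integral, the usual source of such transformations, would require \<open>Re a > 0\<close>; everything is
  therefore derived from series. Gauss's theorem (\<open>gauss_summation\<close>) follows from a contiguous relation and a limit.
  Thomae's transformation (\<open>thomae_transformation\<close>) follows from Gauss's theorem together with the
  finite convolution identity \<open>pfaff_saalschuetz_convolution\<close> by a rearrangement that converges absolutely
  for \<open>Re (e - b - c) \<le> 0\<close>; the other case is reduced to this one because the transformation is an
  involution. Since \<open>\<sigma>\<close> may be a pole of \<open>\<Gamma>\<close>, the series are divided by the Gamma function of the
  coupling parameter throughout.
\<close>

section \<open>Power-law growth of Pochhammer symbols and of the reciprocal Gamma function\<close>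

lemma Re_pos_imp_not_nonpos_Int: "Re z > 0 \<Longrightarrow> z \<notin> \<int>\<^sub>\<le>\<^sub>0"
  by (auto elim!: nonpos_Ints_cases)

text \<open>
  The base \<open>n + 1\<close> keeps the bound meaningful at \<open>n = 0\<close> and makes it hold for every \<open>n\<close>, so that
  bounds can be multiplied uniformly in two indices; a Landau symbol would give them only
  eventually.
\<close>

definition poly_growth :: "(nat \<Rightarrow> 'a::real_normed_vector) \<Rightarrow> real \<Rightarrow> bool" where
  "poly_growth f p \<longleftrightarrow> (\<exists>C\<ge>0. \<forall>n. norm (f n) \<le> C * (real n + 1) powr p)"

lemma poly_growthI:
  assumes "\<And>n. norm (f n) \<le> C * (real n + 1) powr p"
  shows   "poly_growth f p"
proof -
  have "0 \<le> C * (real 0 + 1) powr p"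
    using assms[of 0] norm_ge_zero order_trans by blast
  hence "C \<ge> 0" by simp
  with assms show ?thesis by (auto simp: poly_growth_def)
qed

lemma poly_growthE:
  assumes "poly_growth f p"
  obtains C where "C \<ge> 0" "\<And>n. norm (f n) \<le> C * (real n + 1) powr p"
  using assms by (auto simp: poly_growth_def)

lemma poly_growth_const: "poly_growth (\<lambda>n. c) 0"
  by (rule poly_growthI[where C = "norm c"]) auto

lemma poly_growth_mult:
  fixes f g :: "nat \<Rightarrow> 'a::real_normed_algebra"
  assumes "poly_growth f p" "poly_growth g q"
  shows   "poly_growth (\<lambda>n. f n * g n) (p + q)"
proof -
  obtain C D where C: "C \<ge> 0" "\<And>n. norm (f n) \<le> C * (real n + 1) powr p"
    and D: "D \<ge> 0" "\<And>n. norm (g n) \<le> D * (real n + 1) powr q"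
    using assms by (meson poly_growthE)
  show ?thesis
  proof (rule poly_growthI[where C = "C * D"])
    fix n
    have "norm (f n * g n) \<le> norm (f n) * norm (g n)"
      by (rule norm_mult_ineq)
    also have "\<dots> \<le> (C * (real n + 1) powr p) * (D * (real n + 1) powr q)"
      using C D by (intro mult_mono) auto
    finally show "norm (f n * g n) \<le> C * D * (real n + 1) powr (p + q)"
      by (simp add: powr_add mult_ac)
  qed
qed

lemma poly_growth_cmult:
  fixes f :: "nat \<Rightarrow> 'a::real_normed_algebra"
  shows "poly_growth f p \<Longrightarrow> poly_growth (\<lambda>n. c * f n) p"
  using poly_growth_mult[OF poly_growth_const, of f p c] by simp

text \<open>
  Euler's limit formulas for \<open>\<Gamma>\<close> and \<open>1/\<Gamma>\<close> state the convergence of a sequence divided by the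
  complex power \<open>n\<^sup>z\<close>; this lemma turns them into growth bounds.
\<close>

lemma poly_growth_of_convergent:
  fixes f :: "nat \<Rightarrow> complex"
  assumes "convergent (\<lambda>n. f n * exp (- z * of_real (ln (real n + 1))))"
  shows   "poly_growth f (Re z)"
proof -
  obtain C where C: "\<And>n. norm (f n * exp (- z * of_real (ln (real n + 1)))) \<le> C"
    using convergent_imp_Bseq[OF assms] unfolding Bseq_def by blast
  have "norm (f n) \<le> C * (real n + 1) powr Re z" for n
  proof -
    have *: "norm (exp (- z * of_real (ln (real n + 1)))) = inverse ((real n + 1) powr Re z)"
      by (simp add: powr_def exp_minus norm_inverse)
    have "norm (f n * exp (- z * of_real (ln (real n + 1)))) = norm (f n) / (real n + 1) powr Re z"
      unfolding norm_mult * by (rule divide_inverse [symmetric])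
    hence "norm (f n) / (real n + 1) powr Re z \<le> C" using C[of n] by metis
    thus ?thesis by (subst (asm) pos_divide_le_eq) auto
  qed
  thus ?thesis by (rule poly_growthI)
qed

lemma poly_growth_of_Suc:
  assumes "poly_growth (\<lambda>n. f (Suc n)) p"
  shows   "poly_growth f p"
proof -
  obtain C where C: "C \<ge> 0" "\<And>n. norm (f (Suc n)) \<le> C * (real n + 1) powr p"
    using assms by (meson poly_growthE)
  define D where "D = max (norm (f 0)) (C * 2 powr \<bar>p\<bar>)"
  have "norm (f n) \<le> D * (real n + 1) powr p" for n
  proof (cases n)
    case 0
    thus ?thesis by (simp add: D_def)
  next
    case (Suc m)
    have "(real m + 1) powr p \<le> 2 powr \<bar>p\<bar> * (real m + 2) powr p"
    proof (cases "p \<ge> 0")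
      case True
      have "(real m + 1) powr p \<le> 1 * (real m + 2) powr p"
        using True by (auto intro!: powr_mono2)
      also have "\<dots> \<le> 2 powr \<bar>p\<bar> * (real m + 2) powr p"
        by (intro mult_right_mono) (auto simp: ge_one_powr_ge_zero)
      finally show ?thesis .
    next
      case False
      have "(2 * (real m + 1)) powr p \<le> (real m + 2) powr p"
        using False by (intro powr_mono2') auto
      hence "2 powr p * (real m + 1) powr p \<le> (real m + 2) powr p"
        by (subst powr_mult [symmetric]) simp_all
      thus ?thesis using False by (simp add: powr_minus field_simps)
    qed
    hence "C * (real m + 1) powr p \<le> (C * 2 powr \<bar>p\<bar>) * (real m + 2) powr p"
      using C(1) by (simp add: mult_left_mono mult.assoc)
    also have "\<dots> \<le> D * (real m + 2) powr p"
      by (intro mult_right_mono) (auto simp: D_def)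
    finally have "C * (real m + 1) powr p \<le> D * (real m + 2) powr p" .
    with C(2)[of m] Suc show ?thesis by (simp add: add.commute)
  qed
  thus ?thesis by (rule poly_growthI)
qed

lemma poly_growth_linear: "poly_growth (\<lambda>n. z + of_nat n :: complex) 1"
proof (rule poly_growthI[where C = "norm z + 1"])
  fix n
  have "norm (z + of_nat n) \<le> norm z + real n"
    by (metis norm_of_nat norm_triangle_ineq)
  also have "\<dots> \<le> (norm z + 1) * (real n + 1) powr 1"
    by (simp add: field_simps)
  finally show "norm (z + of_nat n) \<le> (norm z + 1) * (real n + 1) powr 1" .
qed

text \<open>
  Shifting \<open>z\<close> to \<open>z - 1\<close> makes the bound independent of whether \<open>z\<close> is a pole of \<open>\<Gamma>\<close>: the sequence
  converging to \<open>1/\<Gamma>(z - 1)\<close> is bounded in any case. The division by \<open>z - 1\<close> is what singles out \<open>z = 1\<close>.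
\<close>

lemma poly_growth_pochhammer:
  fixes z :: complex
  shows "poly_growth (\<lambda>n. pochhammer z n / fact n) (Re z - 1)"
proof (cases "z = 1")
  case True
  thus ?thesis using poly_growth_const[of "1::complex"] by (simp flip: pochhammer_fact)
next
  case False
  have "(\<lambda>n. rGamma_series (z - 1) (Suc n)) \<longlonglongrightarrow> rGamma (z - 1)"
    by (rule LIMSEQ_Suc) (rule rGamma_series_LIMSEQ)
  hence "(\<lambda>n. rGamma_series (z - 1) (Suc n) / (z - 1)) \<longlonglongrightarrow> rGamma (z - 1) / (z - 1)"
    using False by (intro tendsto_intros) auto
  moreover have "rGamma_series (z - 1) (Suc n) / (z - 1) =
     pochhammer z (Suc n) / fact (Suc n) * exp (- (z - 1) * of_real (ln (real n + 1)))" for n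
  proof -
    define E where "E = exp ((z - 1) * of_real (ln (real n + 1)))"
    have A: "pochhammer (z - 1) (Suc n + 1) = (z - 1) * pochhammer z (Suc n)"
      using pochhammer_rec[of "z - 1" "Suc n"] by simp
    have B: "exp ((z - 1) * of_real (ln (real (Suc n)))) = E"
      unfolding E_def by (simp only: of_nat_Suc add.commute)
    have D: "exp (- (z - 1) * of_real (ln (real n + 1))) = inverse E"
      unfolding E_def mult_minus_left by (rule exp_minus)
    have *: "w * P / (F * E) / w = P / F * inverse E" if "w \<noteq> 0" for w P F E :: complex
      using that by (simp add: inverse_eq_divide)
    show ?thesis
      unfolding rGamma_series_def A B D by (rule *) (use False in simp)
  qed
  ultimately have "convergent (\<lambda>n. pochhammer z (Suc n) / fact (Suc n) *
       exp (- (z - 1) * of_real (ln (real n + 1))))"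
    by (auto simp: convergent_def)
  from poly_growth_of_convergent[OF this]
  have "poly_growth (\<lambda>n. pochhammer z (Suc n) / fact (Suc n)) (Re z - 1)"
    unfolding minus_complex.sel one_complex.sel .
  thus ?thesis by (rule poly_growth_of_Suc)
qed

lemma poly_growth_inverse_pochhammer:
  fixes z :: complex
  assumes "z \<notin> \<int>\<^sub>\<le>\<^sub>0"
  shows   "poly_growth (\<lambda>n. fact n / pochhammer z n) (1 - Re z)"
proof -
  have "(\<lambda>n. Gamma_series' z (Suc n)) \<longlonglongrightarrow> Gamma z"
    by (rule LIMSEQ_Suc) (rule Gamma_series'_LIMSEQ)
  moreover have "Gamma_series' z (Suc n) =
     fact n / pochhammer z (Suc n) * exp (- (- z) * of_real (ln (real n + 1)))" for n
    unfolding Gamma_series'_def by (simp add: add_ac)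
  ultimately have "convergent (\<lambda>n. fact n / pochhammer z (Suc n) *
       exp (- (- z) * of_real (ln (real n + 1))))"
    by (auto simp: convergent_def)
  from poly_growth_of_convergent[OF this]
  have "poly_growth (\<lambda>n. fact n / pochhammer z (Suc n)) (- Re z)" by simp
  from poly_growth_mult[OF poly_growth_linear[of z] this]
  have "poly_growth (\<lambda>n. (z + of_nat n) * (fact n / pochhammer z (Suc n))) (1 - Re z)"
    by simp
  moreover have "(z + of_nat n) * (fact n / pochhammer z (Suc n)) = fact n / pochhammer z n" for n
  proof -
    have "z + of_nat n \<noteq> 0" using assms plus_of_nat_eq_0_imp[of z n] by auto
    thus ?thesis by (simp add: pochhammer_Suc)
  qed
  ultimately show ?thesis by simp
qed

text \<open>
  Away from the poles this is the bound for \<open>1/(z)\<^sub>n\<close>, as \<open>1/\<Gamma>(z + n) = 1/(\<Gamma>(z) (z)\<^sub>n)\<close>. A pole is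
  reached from \<open>z + 1\<close>, since the sequence for \<open>z\<close> at \<open>n + 1\<close> is \<open>n + 1\<close> times the sequence for \<open>z + 1\<close> at \<open>n\<close>.
\<close>

lemma poly_growth_rGamma:
  fixes z :: complex
  shows "poly_growth (\<lambda>n. fact n * rGamma (z + of_nat n)) (1 - Re z)"
proof -
  have "poly_growth (\<lambda>n. fact n * rGamma (z + of_nat n)) (1 - Re z)" if "Re z + real N > 0" for N
    using that
  proof (induction N arbitrary: z)
    case 0
    hence z: "z \<notin> \<int>\<^sub>\<le>\<^sub>0" by (intro Re_pos_imp_not_nonpos_Int) simp
    have "fact n * rGamma (z + of_nat n) = rGamma z * (fact n / pochhammer z n)" for n
      using pochhammer_rGamma[of z n] pochhammer_eq_0_imp_nonpos_Int[of z n] z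
      by auto
    with poly_growth_cmult[OF poly_growth_inverse_pochhammer[OF z], of "rGamma z"]
    show ?case by simp
  next
    case (Suc N)
    have "poly_growth (\<lambda>n. fact n * rGamma (z + 1 + of_nat n)) (1 - Re (z + 1))"
      using Suc.prems by (intro Suc.IH) (auto simp: add_ac)
    from poly_growth_mult[OF poly_growth_linear[of 1] this]
    have "poly_growth (\<lambda>n. fact (Suc n) * rGamma (z + of_nat (Suc n))) (1 - Re z)"
      by (simp add: add_ac mult_ac)
    thus ?case by (rule poly_growth_of_Suc)
  qed
  moreover obtain N where "- Re z < real N"
    using reals_Archimedean2 by blast
  hence "Re z + real N > 0" by simp
  ultimately show ?thesis by blast
qed

lemma summable_powr_Suc:
  assumes "p < -1"
  shows   "summable (\<lambda>n. (real n + 1) powr p)"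
proof -
  have "summable (\<lambda>n. real (Suc n) powr p)"
    using assms by (subst summable_Suc_iff) (simp add: summable_real_powr_iff)
  thus ?thesis by (simp add: add_ac)
qed

lemma poly_growth_imp_summable_norm:
  assumes "poly_growth f p" "p < -1"
  shows   "summable (\<lambda>n. norm (f n))"
proof -
  obtain C where C: "C \<ge> 0" "\<And>n. norm (f n) \<le> C * (real n + 1) powr p"
    using assms by (meson poly_growthE)
  show ?thesis
    by (rule summable_comparison_test'[OF summable_mult[OF summable_powr_Suc[OF assms(2)], of C]])
       (use C in auto)
qed

lemma poly_growth_imp_tendsto_0:
  assumes "poly_growth f p" "p < 0"
  shows   "f \<longlonglongrightarrow> 0"
proof -
  obtain C where C: "C \<ge> 0" "\<And>n. norm (f n) \<le> C * (real n + 1) powr p"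
    using assms by (meson poly_growthE)
  have "(\<lambda>n. (real n + 1) powr p) \<longlonglongrightarrow> 0"
    using tendsto_neg_powr[OF assms(2)
      filterlim_compose[OF filterlim_real_sequentially filterlim_Suc]]
    unfolding of_nat_Suc by (subst add.commute)
  hence *: "(\<lambda>n. C * (real n + 1) powr p) \<longlonglongrightarrow> 0"
    by (rule tendsto_mult_right_zero)
  show ?thesis
    by (rule Lim_null_comparison[OF _ *]) (use C in auto)
qed

lemma summable_on_of_powr_bound:
  fixes T :: "nat \<Rightarrow> nat \<Rightarrow> complex"
  assumes T: "\<And>m n. norm (T m n) \<le> C * ((real m + 1) powr p * (real n + 1) powr q)"
    and "p < -1" "q < -1"
  shows "(\<lambda>(m, n). T m n) summable_on UNIV"
proof -
  have 1: "(\<lambda>n. (real n + 1) powr p) summable_on UNIV" if "p < -1" for p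
    using summable_powr_Suc[OF that] by (subst summable_on_UNIV_nonneg_real_iff) auto
  have "(\<lambda>(m, n). (real m + 1) powr p * (real n + 1) powr q) summable_on Sigma UNIV (\<lambda>_. UNIV)"
  proof (rule summable_on_SigmaI)
    fix m :: nat
    show "((\<lambda>n. case (m, n) of (m, n) \<Rightarrow> (real m + 1) powr p * (real n + 1) powr q) has_sum
            ((real m + 1) powr p * (\<Sum>\<^sub>\<infinity>n. (real n + 1) powr q))) UNIV"
      using 1[OF assms(3)] by (auto intro!: has_sum_cmult_right)
  qed (use 1[OF assms(2)] in \<open>auto intro!: summable_on_cmult_left\<close>)
  hence "(\<lambda>x. C * (case x of (m, n) \<Rightarrow> (real m + 1) powr p * (real n + 1) powr q)) summable_on UNIV"
    by (intro summable_on_cmult_right) simp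
  hence "(\<lambda>x. norm (case x of (m, n) \<Rightarrow> T m n)) summable_on UNIV"
    by (rule Infinite_Sum.abs_summable_on_comparison_test') (use T in auto)
  thus ?thesis by (rule abs_summable_summable)
qed

section \<open>Gauss's summation theorem, regularised\<close>

text \<open>
  This is \<open>\<^sub>2F\<^sub>1(b, c; s; 1) / \<Gamma>(s)\<close>, which is defined for every \<open>s\<close> with \<open>Re (s - b - c) > 0\<close>.
  The values of \<open>s\<close> for which the unnormalised series is undefined do occur below.
\<close>

definition gauss_series :: "complex \<Rightarrow> complex \<Rightarrow> complex \<Rightarrow> complex" where
  "gauss_series b c s =
     (\<Sum>n. pochhammer b n * pochhammer c n / fact n * rGamma (s + of_nat n))"

lemma poly_growth_gauss:
  "poly_growth (\<lambda>n. pochhammer b n * pochhammer c n / fact n * rGamma (s + of_nat n))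
     (Re (b + c - s) - 1)"
proof -
  have "poly_growth (\<lambda>n. pochhammer b n / fact n * (pochhammer c n / fact n) *
          (fact n * rGamma (s + of_nat n))) (Re b - 1 + (Re c - 1) + (1 - Re s))"
    by (intro poly_growth_mult poly_growth_pochhammer poly_growth_rGamma)
  thus ?thesis by (simp add: algebra_simps)
qed

lemma summable_gauss:
  assumes "Re (s - b - c) > 0"
  shows "summable (\<lambda>n. norm (pochhammer b n * pochhammer c n / fact n * rGamma (s + of_nat n)))"
  by (rule poly_growth_imp_summable_norm[OF poly_growth_gauss]) (use assms in simp)

text \<open>
  With \<open>u\<^sub>n = (b)\<^sub>n (c)\<^sub>n / n!\<close> and \<open>V\<^sub>n = n u\<^sub>n / \<Gamma>(s + n)\<close>, the difference of the \<open>n\<close>-th terms of the two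
  sides is \<open>V\<^sub>n - V\<^sub>n\<^sub>+\<^sub>1\<close>; and \<open>V\<close> vanishes at \<open>0\<close> and, by the convergence condition, at infinity.
\<close>

lemma gauss_series_contiguous:
  assumes "Re (s - b - c) > 0"
  shows   "(s - b - c) * gauss_series b c s = (s - b) * (s - c) * gauss_series b c (s + 1)"
proof -
  define u where "u = (\<lambda>n. pochhammer b n * pochhammer c n / fact n)"
  define V where "V = (\<lambda>n. of_nat n * (u n * rGamma (s + of_nat n)))"
  have "poly_growth (\<lambda>n. (0 + of_nat n) * (u n * rGamma (s + of_nat n))) (1 + (Re (b + c - s) - 1))"
    unfolding u_def by (intro poly_growth_mult[OF poly_growth_linear] poly_growth_gauss)
  hence V0: "V \<longlonglongrightarrow> 0"
    unfolding V_def by (intro poly_growth_imp_tendsto_0) (use assms in auto)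
  have tel: "(s - b - c) * (u n * rGamma (s + of_nat n)) -
          (s - b) * (s - c) * (u n * rGamma (s + 1 + of_nat n)) = V n - V (Suc n)" for n
  proof -
    have r: "rGamma (s + of_nat n) = (s + of_nat n) * rGamma (s + 1 + of_nat n)"
      using rGamma_plus1[of "s + of_nat n"] by (simp add: add_ac)
    have u: "of_nat (Suc n) * u (Suc n) = (b + of_nat n) * (c + of_nat n) * u n"
    proof -
      have "of_nat (Suc n) * u (Suc n) =
          of_nat (Suc n) * (pochhammer b n * (b + of_nat n) * (pochhammer c n * (c + of_nat n)) /
             (of_nat (Suc n) * fact n))"
        unfolding u_def pochhammer_Suc fact_Suc by simp
      also have "\<dots> = (b + of_nat n) * (c + of_nat n) * u n"
        unfolding u_def by (simp del: of_nat_Suc)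
      finally show ?thesis .
    qed
    have "V (Suc n) = (of_nat (Suc n) * u (Suc n)) * rGamma (s + 1 + of_nat n)"
      by (simp add: V_def add_ac)
    also have "\<dots> = (b + of_nat n) * (c + of_nat n) * u n * rGamma (s + 1 + of_nat n)"
      by (simp only: u)
    finally have V: "V (Suc n) = (b + of_nat n) * (c + of_nat n) * u n * rGamma (s + 1 + of_nat n)" .
    show ?thesis
      unfolding V unfolding V_def r by (simp add: algebra_simps)
  qed
  have "(\<lambda>n. V n - V (Suc n)) sums (V 0 - 0)"
    by (rule telescope_sums'[OF V0])
  hence *: "(\<lambda>n. V n - V (Suc n)) sums 0" by (simp add: V_def)
  have 1: "summable (\<lambda>n. u n * rGamma (s + of_nat n))"
    unfolding u_def by (rule summable_norm_cancel[OF summable_gauss[OF assms]])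
  have 2: "summable (\<lambda>n. u n * rGamma (s + 1 + of_nat n))"
    unfolding u_def by (rule summable_norm_cancel[OF summable_gauss]) (use assms in auto)
  have "(\<lambda>n. (s - b - c) * (u n * rGamma (s + of_nat n)) -
          (s - b) * (s - c) * (u n * rGamma (s + 1 + of_nat n))) sums
        ((s - b - c) * gauss_series b c s - (s - b) * (s - c) * gauss_series b c (s + 1))"
    using 1 2 unfolding gauss_series_def u_def
    by (intro sums_diff sums_mult summable_sums)
  hence "(s - b - c) * gauss_series b c s - (s - b) * (s - c) * gauss_series b c (s + 1) = 0"
    unfolding tel by (rule sums_unique2[OF _ *])
  thus ?thesis by simp
qed

text \<open>
  Termwise, \<open>\<^sub>2F\<^sub>1(b, c; s + N; 1)\<close> tends to its zeroth term \<open>1\<close>. As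
  \<open>\<bar>(s + N)\<^sub>k\<bar> \<ge> (Re s)\<^sub>k > 0\<close>, replacing \<open>s + N\<close> by \<open>Re s\<close> gives a dominating series, so Tannery's theorem
  applies.
\<close>

lemma gauss_series_asymptotics:
  assumes "Re s > 0" and "Re (s - b - c) > 0"
  shows   "(\<lambda>N. Gamma (s + of_nat N) * gauss_series b c (s + of_nat N)) \<longlonglongrightarrow> 1"
proof -
  define u where "u = (\<lambda>n. pochhammer b n * pochhammer c n / fact n)"
  have npos: "s + of_nat N \<notin> \<int>\<^sub>\<le>\<^sub>0" for N
    by (rule Re_pos_imp_not_nonpos_Int) (use assms(1) in simp)
  have rs: "complex_of_real (Re s) \<notin> \<int>\<^sub>\<le>\<^sub>0"
    by (rule Re_pos_imp_not_nonpos_Int) (use assms(1) in simp)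
  have "(\<lambda>N. \<Sum>k. u k * inverse (pochhammer (s + of_nat N) k)) \<longlonglongrightarrow> (\<Sum>k. u k * (\<Prod>i<k. 0))"
  proof (rule tannerys_theorem[THEN conjunct2, THEN conjunct2])
    fix k
    have "(\<lambda>N. \<Prod>i<k. inverse (s + of_nat N + of_nat i)) \<longlonglongrightarrow> (\<Prod>i<k. 0)"
    proof (rule tendsto_prod)
      fix i
      have "filterlim (\<lambda>N. (s + of_nat i) + of_nat N) at_infinity sequentially"
        by (rule tendsto_add_filterlim_at_infinity[OF tendsto_const tendsto_of_nat])
      hence "filterlim (\<lambda>N. s + of_nat N + of_nat i) at_infinity sequentially"
        by (simp add: add_ac)
      thus "(\<lambda>N. inverse (s + of_nat N + of_nat i)) \<longlonglongrightarrow> 0"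
        by (rule filterlim_compose[OF tendsto_inverse_0])
    qed
    thus "(\<lambda>N. u k * inverse (pochhammer (s + of_nat N) k)) \<longlonglongrightarrow> u k * (\<Prod>i<k. 0)"
      by (intro tendsto_intros) (simp add: pochhammer_prod atLeast0LessThan o_def flip: prod_inversef)
  next
    have le: "norm (u k * inverse (pochhammer (s + of_nat N) k)) \<le>
       norm (u k / pochhammer (of_real (Re s)) k)" for k N
    proof -
      have 1: "pochhammer (Re s) k \<le> norm (pochhammer (s + of_nat N) k)"
        unfolding pochhammer_prod prod_norm [symmetric]
      proof (rule prod_mono)
        fix i
        have "Re s + real i \<le> Re (s + of_nat N + of_nat i)" by simp
        also have "\<dots> \<le> norm (s + of_nat N + of_nat i)" by (rule complex_Re_le_cmod)
        finally show "0 \<le> Re s + of_nat i \<and> Re s + of_nat i \<le> norm (s + of_nat N + of_nat i)"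
          using assms(1) by simp
      qed
      have 2: "pochhammer (Re s) k > 0" using assms(1) by (rule pochhammer_pos)
      have "norm (pochhammer (complex_of_real (Re s)) k) = pochhammer (Re s) k"
        using 2 by (simp add: pochhammer_of_real)
      thus ?thesis using 1 2
        by (simp add: norm_mult norm_divide norm_inverse divide_inverse mult_left_mono le_imp_inverse_le)
    qed
    show "\<forall>\<^sub>F (k, N) in at_top \<times>\<^sub>F sequentially.
            norm (u k * inverse (pochhammer (s + of_nat N) k)) \<le>
            norm (u k / pochhammer (of_real (Re s)) k)"
      by (rule always_eventually) (use le in auto)
  next
    have "poly_growth (\<lambda>n. pochhammer b n / fact n * (pochhammer c n / fact n) *
            (fact n / pochhammer (of_real (Re s)) n))
            (Re b - 1 + (Re c - 1) + (1 - Re (complex_of_real (Re s))))"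
      by (intro poly_growth_mult poly_growth_pochhammer poly_growth_inverse_pochhammer rs)
    hence "poly_growth (\<lambda>n. u n / pochhammer (of_real (Re s)) n)
            (Re b - 1 + (Re c - 1) + (1 - Re (complex_of_real (Re s))))"
      by (simp add: u_def)
    thus "summable (\<lambda>k. norm (u k / pochhammer (of_real (Re s)) k))"
      by (rule poly_growth_imp_summable_norm) (use assms in simp)
  qed simp
  moreover have "(\<Sum>k. u k * (\<Prod>i<k. 0)) = 1"
  proof -
    have "(\<Sum>k. u k * (\<Prod>i<k. 0)) = (\<Sum>k\<in>{0}. u k * (\<Prod>i<k. 0))"
      by (rule suminf_finite) auto
    thus ?thesis by (simp add: u_def)
  qed
  moreover have "Gamma (s + of_nat N) * gauss_series b c (s + of_nat N) =
                   (\<Sum>k. u k * inverse (pochhammer (s + of_nat N) k))" for N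
  proof -
    have sm: "summable (\<lambda>n. u n * rGamma (s + of_nat N + of_nat n))"
      unfolding u_def by (rule summable_norm_cancel[OF summable_gauss]) (use assms in auto)
    have "Gamma (s + of_nat N) * (u k * rGamma (s + of_nat N + of_nat k)) =
            u k * inverse (pochhammer (s + of_nat N) k)" for k
      using npos[of N] pochhammer_Gamma[of "s + of_nat N" k]
      by (simp add: rGamma_inverse_Gamma field_simps)
    hence "(\<Sum>k. Gamma (s + of_nat N) * (u k * rGamma (s + of_nat N + of_nat k))) =
             (\<Sum>k. u k * inverse (pochhammer (s + of_nat N) k))"
      by presburger
    thus ?thesis
      using suminf_mult[OF sm, of "Gamma (s + of_nat N)"]
      unfolding gauss_series_def u_def by argo
  qed
  ultimately show ?thesis by simp
qed

text \<open>
  For \<open>Re s > 0\<close> iterate the contiguous relation from \<open>s\<close> to \<open>s + N\<close>: the factors collect into Pochhammer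
  symbols, whose quotient tends to a quotient of Gamma functions, and the remaining series tends to
  \<open>1\<close>. The relation then carries the formula down to all \<open>s\<close>. Both steps treat the formula multiplied by
  \<open>1/\<Gamma>(s - b - c)\<close>, which keeps it free of denominators.
\<close>

lemma gauss_series_eq:
  assumes "Re (s - b - c) > 0"
  shows   "gauss_series b c s = Gamma (s - b - c) * rGamma (s - b) * rGamma (s - c)"
proof -
  have main: "gauss_series b c s * rGamma (s - b - c) = rGamma (s - b) * rGamma (s - c)"
    if "Re s + real N > 0" "Re (s - b - c) > 0" for N
    using that
  proof (induction N arbitrary: s)
    case 0
    have s: "s \<notin> \<int>\<^sub>\<le>\<^sub>0" "s - b - c \<notin> \<int>\<^sub>\<le>\<^sub>0"
      using 0 by (auto intro!: Re_pos_imp_not_nonpos_Int)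
    have iter: "pochhammer (s - b - c) n * gauss_series b c s =
            pochhammer (s - b) n * pochhammer (s - c) n * gauss_series b c (s + of_nat n)" for n
    proof (induction n)
      case (Suc n)
      have "pochhammer (s - b - c) (Suc n) * gauss_series b c s =
              (s + of_nat n - b - c) * (pochhammer (s - b - c) n * gauss_series b c s)"
        by (simp add: pochhammer_Suc algebra_simps)
      also have "\<dots> = pochhammer (s - b) n * pochhammer (s - c) n *
          ((s + of_nat n - b - c) * gauss_series b c (s + of_nat n))"
        unfolding Suc.IH by (simp only: mult_ac)
      also have "(s + of_nat n - b - c) * gauss_series b c (s + of_nat n) =
          (s + of_nat n - b) * (s + of_nat n - c) * gauss_series b c (s + of_nat n + 1)"
        by (rule gauss_series_contiguous) (use 0 in simp)
      also have "s + of_nat n + 1 = s + of_nat (Suc n)" by simp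
      finally show ?case by (simp only: pochhammer_Suc mult_ac diff_add_eq)
    qed simp
    define R where "R = (\<lambda>N. rGamma_series (s - b) N * rGamma_series (s - c) N / rGamma_series s N *
        (Gamma (s + of_nat (Suc N)) * gauss_series b c (s + of_nat (Suc N))) * rGamma s)"
    have "R \<longlonglongrightarrow> rGamma (s - b) * rGamma (s - c) / rGamma s * 1 * rGamma s"
      unfolding R_def
      by (intro tendsto_intros LIMSEQ_Suc[OF gauss_series_asymptotics])
         (use 0 s in \<open>auto simp: rGamma_eq_zero_iff\<close>)
    hence lim: "R \<longlonglongrightarrow> rGamma (s - b) * rGamma (s - c)"
      using s by (simp add: rGamma_eq_zero_iff)
    have lim': "(\<lambda>N. rGamma_series (s - b - c) N * gauss_series b c s) \<longlonglongrightarrow>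
             rGamma (s - b - c) * gauss_series b c s"
      by (intro tendsto_intros)
    have R: "rGamma_series (s - b - c) N * gauss_series b c s = R N" for N
    proof -
      have nz: "Gamma s \<noteq> 0" "pochhammer s (N + 1) \<noteq> 0"
        using s(1) pochhammer_eq_0_imp_nonpos_Int[of s "N + 1"] by (auto simp: Gamma_eq_zero_iff)
      have G: "Gamma (s + of_nat (Suc N)) = pochhammer s (N + 1) * Gamma s"
        using pochhammer_Gamma[OF s(1), of "N + 1"] nz by (simp add: field_simps)
      define L where "L = complex_of_real (ln (of_nat N))"
      have "rGamma_series (s - b - c) N * gauss_series b c s =
          pochhammer (s - b) (N + 1) * pochhammer (s - c) (N + 1) *
            gauss_series b c (s + of_nat (N + 1)) / (fact N * exp ((s - b - c) * L))"
        using iter[of "N + 1"] unfolding rGamma_series_def L_def by (simp add: field_simps)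
      also have "exp ((s - b - c) * L) = exp ((s - b) * L) * exp ((s - c) * L) / exp (s * L)"
        by (simp add: algebra_simps flip: exp_add exp_diff)
      also have "gauss_series b c (s + of_nat (N + 1)) =
         Gamma (s + of_nat (Suc N)) * gauss_series b c (s + of_nat (Suc N)) * rGamma s
           / pochhammer s (N + 1)"
        unfolding G using nz by (simp add: rGamma_inverse_Gamma)
      also have "pochhammer (s - b) (N + 1) * pochhammer (s - c) (N + 1) *
         (Gamma (s + of_nat (Suc N)) * gauss_series b c (s + of_nat (Suc N)) * rGamma s
           / pochhammer s (N + 1)) /
          (fact N * (exp ((s - b) * L) * exp ((s - c) * L) / exp (s * L))) = R N"
        unfolding R_def rGamma_series_def L_def [symmetric] by (simp add: divide_simps)
      finally show ?thesis .
    qed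
    from LIMSEQ_unique[OF lim'[unfolded R] lim] show ?case by (simp add: mult.commute)
  next
    case (Suc N)
    have rG: "rGamma (s - x) = (s - x) * rGamma (s + 1 - x)" for x
      using rGamma_plus1[of "s - x"] by (simp add: diff_add_eq)
    have "gauss_series b c s * rGamma (s - b - c) =
            ((s - b - c) * gauss_series b c s) * rGamma (s + 1 - b - c)"
      using rG[of "b + c"] by (simp add: diff_diff_eq mult_ac)
    also have "\<dots> = (s - b) * (s - c) * (gauss_series b c (s + 1) * rGamma (s + 1 - b - c))"
      using gauss_series_contiguous[OF Suc.prems(2)] by simp
    also have "gauss_series b c (s + 1) * rGamma (s + 1 - b - c) =
               rGamma (s + 1 - b) * rGamma (s + 1 - c)"
      by (rule Suc.IH) (use Suc.prems in auto)
    also have "(s - b) * (s - c) * (rGamma (s + 1 - b) * rGamma (s + 1 - c)) =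
               rGamma (s - b) * rGamma (s - c)"
      by (simp only: rG mult_ac)
    finally show ?case .
  qed
  obtain N where "- Re s < real N"
    using reals_Archimedean2 by blast
  hence "Re s + real N > 0" by simp
  from main[OF this assms] have "gauss_series b c s * rGamma (s - b - c) = rGamma (s - b) * rGamma (s - c)" .
  moreover have "Gamma (s - b - c) \<noteq> 0"
    using Re_pos_imp_not_nonpos_Int[OF assms] by (simp add: Gamma_eq_zero_iff)
  ultimately show ?thesis by (simp add: rGamma_inverse_Gamma field_simps)
qed

theorem gauss_summation:
  assumes "Re (s - b - c) > 0"
  shows   "(\<Sum>\<^sub>\<infinity>n. pochhammer b n * pochhammer c n / fact n * rGamma (s + of_nat n)) =
             Gamma (s - b - c) * rGamma (s - b) * rGamma (s - c)"
proof -
  have "(\<lambda>n. pochhammer b n * pochhammer c n / fact n * rGamma (s + of_nat n)) sums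
          gauss_series b c s"
    unfolding gauss_series_def
    by (rule summable_sums[OF summable_norm_cancel[OF summable_gauss[OF assms]]])
  from norm_summable_imp_has_sum[OF summable_gauss[OF assms] this]
  show ?thesis using gauss_series_eq[OF assms] by (simp add: infsumI)
qed

section \<open>Euler's transformation, coefficientwise\<close>

text \<open>
  Comparison of coefficients in \<open>\<^sub>2F\<^sub>1(b, c; e; x) = (1 - x) powr (e - b - c) \<cdot> \<^sub>2F\<^sub>1(e - b, e - c; e; x)\<close>.
  Both sides satisfy the same first-order recurrence in \<open>m\<close>; for the sum this is shown by creative
  telescoping, with \<open>H k = k (e + k - 1) x\<^sub>k y\<^sub>m\<^sub>+\<^sub>1\<^sub>-\<^sub>k\<close> as the certificate.
\<close>

lemma pfaff_saalschuetz_convolution: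
  fixes b c e :: complex
  assumes "e \<notin> \<int>\<^sub>\<le>\<^sub>0"
  shows "(\<Sum>k\<le>m. pochhammer (e - b) k * pochhammer (e - c) k / (pochhammer e k * fact k) *
            (pochhammer (b + c - e) (m - k) / fact (m - k))) =
         pochhammer b m * pochhammer c m / (pochhammer e m * fact m)"
proof -
  define x where "x = (\<lambda>k. pochhammer (e - b) k * pochhammer (e - c) k / (pochhammer e k * fact k))"
  define y where "y = (\<lambda>j. pochhammer (b + c - e) j / fact j)"
  define S where "S = (\<lambda>m. \<Sum>k\<le>m. x k * y (m - k))"
  have e_nz: "e + of_nat k \<noteq> 0" for k
    using assms plus_of_nat_eq_0_imp[of e k] by auto
  have e_nz': "pochhammer e k \<noteq> 0" for k
    using assms pochhammer_eq_0_imp_nonpos_Int[of e k] by auto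
  have x_Suc: "of_nat (Suc k) * (e + of_nat k) * x (Suc k) =
                 (e - b + of_nat k) * (e - c + of_nat k) * x k" for k
    unfolding x_def pochhammer_Suc fact_Suc using e_nz[of k]
    by (simp add: divide_simps e_nz' del: of_nat_Suc)
  have y_Suc: "of_nat (Suc j) * y (Suc j) = (b + c - e + of_nat j) * y j" for j
    unfolding y_def pochhammer_Suc fact_Suc by (simp add: divide_simps del: of_nat_Suc)
  have rec: "of_nat (Suc m) * (e + of_nat m) * S (Suc m) = (b + of_nat m) * (c + of_nat m) * S m" for m
  proof -
    define H where "H = (\<lambda>k. of_nat k * (e + of_nat k - 1) * (x k * y (Suc m - k)))"
    have tel: "of_nat (Suc m) * (e + of_nat m) * (x k * y (Suc m - k)) -
            (b + of_nat m) * (c + of_nat m) * (x k * y (m - k)) = H k - H (Suc k)" if "k \<le> m" for k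
    proof -
      define j where "j = m - k"
      have m: "m = k + j" "Suc m - k = Suc j" "m - k = j" using that by (auto simp: j_def)
      have H: "H (Suc k) = (e - b + of_nat k) * (e - c + of_nat k) * x k * y j"
        unfolding x_Suc [symmetric] by (simp add: H_def m(3))
      have y: "(1 + of_nat j) * y (Suc j) = (b + c - e + of_nat j) * y j"
        using y_Suc[of j] by simp
      show ?thesis
        unfolding H unfolding H_def m(2,3) unfolding m(1) of_nat_Suc of_nat_add using y by algebra
    qed
    define P Q where "P = of_nat (Suc m) * (e + of_nat m)" and "Q = (b + of_nat m) * (c + of_nat m)"
    have "H 0 - H (Suc m) = (\<Sum>k\<le>m. H k - H (Suc k))"
      by (simp add: sum_telescope)
    also have "\<dots> = (\<Sum>k\<le>m. P * (x k * y (Suc m - k)) - Q * (x k * y (m - k)))"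
      unfolding P_def Q_def by (intro sum.cong refl tel [symmetric]) simp
    also have "\<dots> = P * (\<Sum>k\<le>m. x k * y (Suc m - k)) - Q * S m"
      by (simp only: sum_subtractf sum_distrib_left S_def)
    also have "(\<Sum>k\<le>m. x k * y (Suc m - k)) = S (Suc m) - x (Suc m) * y 0"
      by (simp add: S_def)
    also have "P * (S (Suc m) - x (Suc m) * y 0) = P * S (Suc m) - H (Suc m)"
      by (simp add: P_def H_def algebra_simps)
    finally have "P * S (Suc m) = Q * S m" by (simp add: H_def)
    thus ?thesis by (simp only: P_def Q_def)
  qed
  have "S m = pochhammer b m * pochhammer c m / (pochhammer e m * fact m)"
  proof (induction m)
    case 0
    show ?case by (simp add: S_def x_def y_def)
  next
    case (Suc m)
    have "of_nat (Suc m) * (e + of_nat m) * S (Suc m) =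
       of_nat (Suc m) * (e + of_nat m) *
       (pochhammer b (Suc m) * pochhammer c (Suc m) / (pochhammer e (Suc m) * fact (Suc m)))"
      unfolding rec Suc.IH pochhammer_Suc fact_Suc using e_nz[of m]
      by (simp add: divide_simps e_nz' del: of_nat_Suc)
    moreover have "of_nat (Suc m) * (e + of_nat m) \<noteq> 0"
      using e_nz[of m] by (simp del: of_nat_Suc)
    ultimately show ?case using mult_left_cancel by blast
  qed
  thus ?thesis by (simp add: S_def x_def y_def)
qed

section \<open>Absolute convergence of the double series\<close>

text \<open>
  By symmetry let \<open>m \<le> n\<close>. If the quotient \<open>(m + 1) (n + 1) / (m + n + 1) \<le> m + 1\<close> enters with a positive
  exponent, the factor \<open>m! n! / (m + n)! \<le> 2 powr (- m)\<close> outweighs it.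
\<close>

lemma fact_mult_fact_powr_bound:
  fixes D :: real
  shows "\<exists>K\<ge>0. \<forall>m n. fact m * fact n / fact (m + n) * (real (m + n) + 1) powr (1 - D) \<le>
            K * ((real m + 1) powr (1 - D) * (real n + 1) powr (1 - D))"
proof (cases "D \<le> 1")
  case True
  have "fact m * fact n / fact (m + n) * (real (m + n) + 1) powr (1 - D) \<le>
            1 * ((real m + 1) powr (1 - D) * (real n + 1) powr (1 - D))" for m n
  proof (rule mult_mono)
    have "fact m * fact n \<le> (fact (m + n) :: nat)"
      by (intro dvd_imp_le fact_fact_dvd_fact) simp
    hence "fact m * fact n \<le> (fact (m + n) :: real)"
      by (metis of_nat_fact of_nat_le_iff of_nat_mult)
    thus "fact m * fact n / fact (m + n) \<le> (1 :: real)" by simp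
    have "(real (m + n) + 1) powr (1 - D) \<le> ((real m + 1) * (real n + 1)) powr (1 - D)"
      using True by (intro powr_mono2) (auto simp: algebra_simps)
    thus "(real (m + n) + 1) powr (1 - D) \<le> (real m + 1) powr (1 - D) * (real n + 1) powr (1 - D)"
      by (simp add: powr_mult)
  qed auto
  thus ?thesis by (intro exI[of _ 1]) auto
next
  case False
  define E where "E = D - 1"
  have E: "E > 0" "1 - D = -E" using False by (auto simp: E_def)
  have "(\<lambda>m. (real m + 1) powr E / 2 ^ m) \<longlonglongrightarrow> 0"
    using E(1) by real_asymp
  hence "Bseq (\<lambda>m. (real m + 1) powr E / 2 ^ m)"
    by (intro convergent_imp_Bseq) (auto simp: convergent_def)
  then obtain K where K: "K > 0" "\<And>m. norm ((real m + 1) powr E / 2 ^ m) \<le> K"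
    unfolding Bseq_def by blast
  have le: "fact m * fact n / fact (m + n) * (real (m + n) + 1) powr (1 - D) \<le>
            K * ((real m + 1) powr (1 - D) * (real n + 1) powr (1 - D))" if "m \<le> n" for m n
  proof -
    have "2 ^ m \<le> (real (m + n) / real m) ^ m"
    proof (cases "m = 0")
      case False
      thus ?thesis using that by (intro power_mono) (auto simp: field_simps)
    qed auto
    also have "\<dots> \<le> real (m + n choose m)"
      by (rule binomial_ge_n_over_k_pow_k) auto
    also have "\<dots> = fact (m + n) / (fact m * fact n)"
      by (simp add: binomial_fact)
    finally have 1: "fact m * fact n / fact (m + n) \<le> 1 / (2 ^ m :: real)"
      by (simp add: divide_simps mult_ac)
    have "(real n + 1) powr E \<le> (real (m + n) + 1) powr E"
      using E by (intro powr_mono2) auto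
    hence 2: "(real (m + n) + 1) powr (- E) \<le> (real n + 1) powr (- E)"
      by (simp add: powr_minus)
    have "fact m * fact n / fact (m + n) * (real (m + n) + 1) powr (- E) \<le>
            1 / 2 ^ m * (real n + 1) powr (- E)"
      by (intro mult_mono 1 2) auto
    also have "\<dots> = ((real m + 1) powr E / 2 ^ m) * ((real m + 1) powr (- E) * (real n + 1) powr (- E))"
      by (simp add: powr_minus)
    also have "\<dots> \<le> K * ((real m + 1) powr (- E) * (real n + 1) powr (- E))"
      using K(2)[of m] by (intro mult_right_mono) auto
    finally show ?thesis unfolding E(2) .
  qed
  have "fact m * fact n / fact (m + n) * (real (m + n) + 1) powr (1 - D) \<le>
            K * ((real m + 1) powr (1 - D) * (real n + 1) powr (1 - D))" for m n
    using le[of m n] le[of n m] by (cases "m \<le> n") (simp_all add: mult_ac add_ac)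
  thus ?thesis using K(1) by (intro exI[of _ K]) auto
qed

text \<open>
  The factor \<open>1/\<Gamma>(d + m + n)\<close> couples the two indices, but its bound splits into a product of a function of
  \<open>m\<close> and a function of \<open>n\<close>. This one criterion covers the given double series as well as the one
  obtained from it by Thomae's transformation of the inner sums.
\<close>

lemma summable_on_double_rGamma:
  fixes f g :: "nat \<Rightarrow> complex"
  assumes f: "poly_growth (\<lambda>n. f n / fact n) p" and g: "poly_growth (\<lambda>n. g n / fact n) q"
    and "p < Re d - 2" "q < Re d - 2"
  shows "(\<lambda>(m, n). f m * g n * rGamma (d + of_nat (m + n))) summable_on UNIV"
proof -
  obtain C1 where C1: "C1 \<ge> 0" "\<And>n. norm (f n / fact n) \<le> C1 * (real n + 1) powr p"
    using poly_growthE[OF f] by blast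
  obtain C2 where C2: "C2 \<ge> 0" "\<And>n. norm (g n / fact n) \<le> C2 * (real n + 1) powr q"
    using poly_growthE[OF g] by blast
  obtain C3 where C3: "C3 \<ge> 0"
    "\<And>n. norm (fact n * rGamma (d + of_nat n)) \<le> C3 * (real n + 1) powr (1 - Re d)"
    using poly_growthE[OF poly_growth_rGamma] by blast
  obtain K where K: "K \<ge> 0" "\<And>m n. fact m * fact n / fact (m + n) * (real (m + n) + 1) powr (1 - Re d) \<le>
            K * ((real m + 1) powr (1 - Re d) * (real n + 1) powr (1 - Re d))"
    using fact_mult_fact_powr_bound[of "Re d"] by blast
  show ?thesis
  proof (rule summable_on_of_powr_bound)
    fix m n
    have "norm (f m * g n * rGamma (d + of_nat (m + n))) =
       fact m * fact n / fact (m + n) * (norm (f m / fact m) * norm (g n / fact n) *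
         norm (fact (m + n) * rGamma (d + of_nat (m + n))))"
      by (simp add: norm_mult norm_divide)
    also have "\<dots> \<le> fact m * fact n / fact (m + n) *
         (C1 * (real m + 1) powr p * (C2 * (real n + 1) powr q) *
            (C3 * (real (m + n) + 1) powr (1 - Re d)))"
      using C1(1) C2(1) by (intro mult_left_mono mult_mono C1(2) C2(2) C3(2)) auto
    also have "\<dots> = C1 * C2 * C3 * (real m + 1) powr p * (real n + 1) powr q *
         (fact m * fact n / fact (m + n) * (real (m + n) + 1) powr (1 - Re d))"
      by (simp only: divide_inverse mult_ac)
    also have "\<dots> \<le> C1 * C2 * C3 * (real m + 1) powr p * (real n + 1) powr q *
         (K * ((real m + 1) powr (1 - Re d) * (real n + 1) powr (1 - Re d)))"
      using C1(1) C2(1) C3(1) by (intro mult_left_mono K(2)) auto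
    also have "\<dots> = C1 * C2 * C3 * K * ((real m + 1) powr (p + (1 - Re d)) *
                      (real n + 1) powr (q + (1 - Re d)))"
      by (simp only: powr_add mult_ac)
    finally show "norm (f m * g n * rGamma (d + of_nat (m + n))) \<le> \<dots>" .
  qed (use assms in auto)
qed

text \<open>
  The exponent \<open>A\<close> of the weight is shared between the indices as \<open>A = u + v\<close> in such a way that both
  resulting exponents fall below \<open>-1\<close>. The sign of \<open>t\<close> matters: for \<open>t \<ge> A\<close> the terms with \<open>j = 0\<close> are not
  summable in general.
\<close>

lemma summable_on_additive_weight:
  fixes f g w :: "nat \<Rightarrow> complex"
  assumes f: "poly_growth f (t - 1)" and g: "poly_growth g (- t - 1)"
    and w: "poly_growth w (- A)" and t: "t \<le> 0" "A + t > 0"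
  shows "(\<lambda>(k, j). f k * g j * w (k + j)) summable_on UNIV"
proof -
  obtain C1 where C1: "C1 \<ge> 0" "\<And>n. norm (f n) \<le> C1 * (real n + 1) powr (t - 1)"
    using poly_growthE[OF f] by blast
  obtain C2 where C2: "C2 \<ge> 0" "\<And>n. norm (g n) \<le> C2 * (real n + 1) powr (- t - 1)"
    using poly_growthE[OF g] by blast
  obtain C3 where C3: "C3 \<ge> 0" "\<And>n. norm (w n) \<le> C3 * (real n + 1) powr (- A)"
    using poly_growthE[OF w] by blast
  define u v where "u = (A + t) / 2" and "v = (A - t) / 2"
  have uv: "u > 0" "v > 0" "- A = - u + - v" "t < u" "- t < v"
    using t by (auto simp: u_def v_def field_simps)
  show ?thesis
  proof (rule summable_on_of_powr_bound)
    fix k j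
    have "(real (k + j) + 1) powr (- A) = (real (k + j) + 1) powr (- u) * (real (k + j) + 1) powr (- v)"
      unfolding uv(3) by (rule powr_add)
    also have "\<dots> \<le> (real k + 1) powr (- u) * (real j + 1) powr (- v)"
      using uv by (intro mult_mono powr_mono2') auto
    finally have 1: "(real (k + j) + 1) powr (- A) \<le> (real k + 1) powr (- u) * (real j + 1) powr (- v)" .
    have "norm (f k * g j * w (k + j)) = norm (f k) * norm (g j) * norm (w (k + j))"
      by (simp add: norm_mult)
    also have "\<dots> \<le> (C1 * (real k + 1) powr (t - 1)) * (C2 * (real j + 1) powr (- t - 1)) *
         (C3 * (real (k + j) + 1) powr (- A))"
      using C1(1) C2(1) by (intro mult_mono C1(2) C2(2) C3(2)) auto
    also have "\<dots> \<le> (C1 * (real k + 1) powr (t - 1)) * (C2 * (real j + 1) powr (- t - 1)) *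
         (C3 * ((real k + 1) powr (- u) * (real j + 1) powr (- v)))"
      using C1(1) C2(1) C3(1) by (intro mult_left_mono 1) auto
    also have "\<dots> = C1 * C2 * C3 * ((real k + 1) powr (t - 1 + - u) * (real j + 1) powr (- t - 1 + - v))"
      by (simp only: powr_add mult_ac)
    finally show "norm (f k * g j * w (k + j)) \<le> \<dots>" .
  qed (use uv in auto)
qed

section \<open>Thomae's transformation\<close>

lemma poly_growth_3F2_coeff:
  assumes "e \<notin> \<int>\<^sub>\<le>\<^sub>0"
  shows "poly_growth (\<lambda>n. pochhammer a n * pochhammer b n * pochhammer c n /
           (pochhammer e n * fact n) / fact n) (Re (a + b + c - e) - 2)"
proof -
  have "poly_growth (\<lambda>n. pochhammer a n / fact n * (pochhammer b n / fact n) *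
          (pochhammer c n / fact n) * (fact n / pochhammer e n))
          (Re a - 1 + (Re b - 1) + (Re c - 1) + (1 - Re e))"
    by (intro poly_growth_mult poly_growth_pochhammer poly_growth_inverse_pochhammer assms)
  thus ?thesis by (simp add: mult_ac algebra_simps)
qed

text \<open>
  This is \<open>\<^sub>3F\<^sub>2(a, b, c; d, e; 1) / \<Gamma>(d)\<close>. The transformation replaces \<open>d\<close> by \<open>d + e - b - c\<close>, which can be a
  pole of \<open>\<Gamma>\<close>, so that only this normalisation is always meaningful.
\<close>

definition thomae_sum :: "complex \<Rightarrow> complex \<Rightarrow> complex \<Rightarrow> complex \<Rightarrow> complex \<Rightarrow> complex" where
  "thomae_sum a b c d e = (\<Sum>\<^sub>\<infinity>m. pochhammer a m * pochhammer b m * pochhammer c m /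
     (pochhammer e m * fact m) * rGamma (d + of_nat m))"

lemma infsum_diagonals:
  fixes F :: "nat \<Rightarrow> nat \<Rightarrow> complex"
  assumes "(\<lambda>(k, j). F k j) summable_on UNIV"
  shows   "(\<Sum>\<^sub>\<infinity>m. \<Sum>k\<le>m. F k (m - k)) = (\<Sum>\<^sub>\<infinity>k. \<Sum>\<^sub>\<infinity>j. F k j)"
proof -
  have sm: "(\<lambda>(m, k). F k (m - k)) summable_on Sigma UNIV (\<lambda>m. {..m})"
    using assms
    by (subst summable_on_reindex_bij_witness[where j = "\<lambda>(m, k). (k, m - k)" and
          i = "\<lambda>(k, j). (k + j, k)" and T = UNIV and h = "\<lambda>(k, j). F k j"]) auto
  have "(\<Sum>\<^sub>\<infinity>m. \<Sum>k\<le>m. F k (m - k)) = (\<Sum>\<^sub>\<infinity>m. \<Sum>\<^sub>\<infinity>k\<in>{..m}. F k (m - k))"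
    by simp
  also have "\<dots> = (\<Sum>\<^sub>\<infinity>(m, k)\<in>Sigma UNIV (\<lambda>m. {..m}). F k (m - k))"
    by (rule infsum_Sigma'_banach[OF sm])
  also have "\<dots> = (\<Sum>\<^sub>\<infinity>(k, j)\<in>UNIV. F k j)"
    by (rule infsum_reindex_bij_witness[where j = "\<lambda>(m, k). (k, m - k)" and
          i = "\<lambda>(k, j). (k + j, k)"]) auto
  also have "\<dots> = (\<Sum>\<^sub>\<infinity>k. \<Sum>\<^sub>\<infinity>j. F k j)"
    using infsum_Sigma'_banach[of F UNIV "\<lambda>_. UNIV"] assms by simp
  finally show ?thesis .
qed

text \<open>
  Expand \<open>(b)\<^sub>m (c)\<^sub>m / ((e)\<^sub>m m!)\<close> into the convolution of Euler's transformation and sum first over the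
  index \<open>j = m - k\<close> of the binomial factor: that sum is evaluated by Gauss's theorem. The condition on
  \<open>e - b - c\<close> guarantees that the rearrangement converges absolutely.
\<close>

lemma thomae_transformation_nonpos:
  assumes "e \<notin> \<int>\<^sub>\<le>\<^sub>0" and "Re (d - a) > 0" and "Re (d + e - a - b - c) > 0"
    and "Re (e - b - c) \<le> 0"
  shows "thomae_sum a b c d e = Gamma (d + e - a - b - c) * rGamma (d - a) *
           thomae_sum a (e - b) (e - c) (d + e - b - c) e"
proof -
  define x where "x = (\<lambda>k. pochhammer (e - b) k * pochhammer (e - c) k / (pochhammer e k * fact k))"
  define y where "y = (\<lambda>j. pochhammer (b + c - e) j / fact j)"
  define w where "w = (\<lambda>n. pochhammer a n * rGamma (d + of_nat n))"
  have x: "poly_growth x (Re (e - b - c) - 1)"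
  proof -
    have "poly_growth (\<lambda>n. pochhammer (e - b) n / fact n * (pochhammer (e - c) n / fact n) *
            (fact n / pochhammer e n)) (Re (e - b) - 1 + (Re (e - c) - 1) + (1 - Re e))"
      by (intro poly_growth_mult poly_growth_pochhammer poly_growth_inverse_pochhammer assms)
    thus ?thesis unfolding x_def by (simp add: mult_ac algebra_simps)
  qed
  have y: "poly_growth y (- Re (e - b - c) - 1)"
    using poly_growth_pochhammer[of "b + c - e"] by (simp add: y_def algebra_simps)
  have w: "poly_growth w (- Re (d - a))"
    using poly_growth_mult[OF poly_growth_pochhammer[of a] poly_growth_rGamma[of d]]
    by (simp add: w_def)
  have summ: "(\<lambda>(k, j). x k * y j * w (k + j)) summable_on UNIV"
    by (rule summable_on_additive_weight[OF x y w]) (use assms in auto)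
  have "thomae_sum a b c d e = (\<Sum>\<^sub>\<infinity>m. \<Sum>k\<le>m. x k * y (m - k) * w (k + (m - k)))"
    unfolding thomae_sum_def
  proof (rule infsum_cong)
    fix m
    have "(\<Sum>k\<le>m. x k * y (m - k) * w (k + (m - k))) = (\<Sum>k\<le>m. x k * y (m - k)) * w m"
      unfolding sum_distrib_right by (intro sum.cong) auto
    also have "(\<Sum>k\<le>m. x k * y (m - k)) = pochhammer b m * pochhammer c m / (pochhammer e m * fact m)"
      unfolding x_def y_def by (rule pfaff_saalschuetz_convolution[OF assms(1)])
    finally show "pochhammer a m * pochhammer b m * pochhammer c m / (pochhammer e m * fact m) *
        rGamma (d + of_nat m) = (\<Sum>k\<le>m. x k * y (m - k) * w (k + (m - k)))"
      by (simp add: w_def)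
  qed
  also have "\<dots> = (\<Sum>\<^sub>\<infinity>k. \<Sum>\<^sub>\<infinity>j. x k * y j * w (k + j))"
    by (rule infsum_diagonals[OF summ])
  also have "\<dots> = (\<Sum>\<^sub>\<infinity>k. Gamma (d + e - a - b - c) * rGamma (d - a) *
       (pochhammer a k * pochhammer (e - b) k * pochhammer (e - c) k / (pochhammer e k * fact k) *
         rGamma (d + e - b - c + of_nat k)))"
  proof (rule infsum_cong)
    fix k
    have "(\<Sum>\<^sub>\<infinity>j. x k * y j * w (k + j)) = (\<Sum>\<^sub>\<infinity>j. x k * pochhammer a k *
        (pochhammer (a + of_nat k) j * pochhammer (b + c - e) j / fact j *
           rGamma (d + of_nat k + of_nat j)))"
      unfolding w_def y_def pochhammer_product'[of a k] of_nat_add add.assoc [symmetric]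
      by (intro infsum_cong) simp
    also have "\<dots> = x k * pochhammer a k * (\<Sum>\<^sub>\<infinity>j. pochhammer (a + of_nat k) j *
         pochhammer (b + c - e) j / fact j * rGamma (d + of_nat k + of_nat j))"
      by (rule infsum_cmult_right')
    also have "(\<Sum>\<^sub>\<infinity>j. pochhammer (a + of_nat k) j *
         pochhammer (b + c - e) j / fact j * rGamma (d + of_nat k + of_nat j)) =
         Gamma (d + of_nat k - (a + of_nat k) - (b + c - e)) * rGamma (d + of_nat k - (a + of_nat k)) *
           rGamma (d + of_nat k - (b + c - e))"
      by (rule gauss_summation) (use assms in simp)
    also have "d + of_nat k - (a + of_nat k) - (b + c - e) = d + e - a - b - c" by simp
    also have "d + of_nat k - (a + of_nat k) = d - a" by simp
    also have "d + of_nat k - (b + c - e) = d + e - b - c + of_nat k" by simp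
    finally show "(\<Sum>\<^sub>\<infinity>j. x k * y j * w (k + j)) = Gamma (d + e - a - b - c) * rGamma (d - a) *
       (pochhammer a k * pochhammer (e - b) k * pochhammer (e - c) k / (pochhammer e k * fact k) *
         rGamma (d + e - b - c + of_nat k))"
      by (simp add: x_def)
  qed
  also have "\<dots> = Gamma (d + e - a - b - c) * rGamma (d - a) *
           thomae_sum a (e - b) (e - c) (d + e - b - c) e"
    unfolding thomae_sum_def by (rule infsum_cmult_right')
  finally show ?thesis .
qed

text \<open>
  The map from \<open>(b, c, d)\<close> to \<open>(e - b, e - c, d + e - b - c)\<close> is an involution that reverses the sign of
  \<open>e - b - c\<close> and interchanges \<open>d - a\<close> with \<open>d + e - a - b - c\<close>. In the case excluded before, the formula is
  therefore the previous lemma read backwards.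
\<close>

theorem thomae_transformation:
  assumes "e \<notin> \<int>\<^sub>\<le>\<^sub>0" and "Re (d - a) > 0" and "Re (d + e - a - b - c) > 0"
  shows "thomae_sum a b c d e = Gamma (d + e - a - b - c) * rGamma (d - a) *
           thomae_sum a (e - b) (e - c) (d + e - b - c) e"
proof (cases "Re (e - b - c) \<le> 0")
  case True
  with assms show ?thesis by (intro thomae_transformation_nonpos)
next
  case False
  have "thomae_sum a (e - b) (e - c) (d + e - b - c) e =
      Gamma (d + e - b - c + e - a - (e - b) - (e - c)) * rGamma (d + e - b - c - a) *
        thomae_sum a (e - (e - b)) (e - (e - c)) (d + e - b - c + e - (e - b) - (e - c)) e"
    by (rule thomae_transformation_nonpos) (use assms False in auto)
  hence *: "thomae_sum a (e - b) (e - c) (d + e - b - c) e =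
      Gamma (d - a) * rGamma (d + e - a - b - c) * thomae_sum a b c d e"
    by (simp add: algebra_simps)
  have "Gamma (d - a) \<noteq> 0" "Gamma (d + e - a - b - c) \<noteq> 0"
    using Re_pos_imp_not_nonpos_Int[OF assms(2)] Re_pos_imp_not_nonpos_Int[OF assms(3)]
    by (simp_all only: Gamma_eq_zero_iff not_False_eq_True)
  thus ?thesis unfolding * by (simp add: rGamma_inverse_Gamma divide_simps)
qed

section \<open>The reduction formula\<close>

theorem mainTheorem1:
  fixes a b c d e a' b' c' e' :: complex
  assumes "a' = d - a"
    and "e' = d + e - a - b - c"
    and "Re (d + e - a - b - c) > 0"
    and "Re (d + e' - a' - b' - c') > 0"
    and "Re a' > 0"
    and "d \<notin> \<int>\<^sub>\<le>\<^sub>0" and "e \<notin> \<int>\<^sub>\<le>\<^sub>0" and "e' \<notin> \<int>\<^sub>\<le>\<^sub>0"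
    and "d + e' - a' - b' \<notin> \<int>\<^sub>\<le>\<^sub>0" and "d + e' - a' - c' \<notin> \<int>\<^sub>\<le>\<^sub>0"
  shows "kampe_de_feriet d a b c e a' b' c' e' 1 1 =
    Gamma d * Gamma e' * Gamma (d + e' - a' - b' - c') /
      (Gamma a' * Gamma (d + e' - a' - b') * Gamma (d + e' - a' - c')) *
    pFq [a, e - b, e - c, d + e' - a' - b' - c'] [e, d + e' - a' - b', d + e' - a' - c'] 1"
proof -
  \<comment> \<open>\<open>\<sigma>\<close> is the coupling parameter of the double series after Thomae's transformation; it may be a
    non-positive integer.\<close>
  define \<sigma> where "\<sigma> = d + e' - a'"
  define s where "s = \<sigma> - b' - c'"
  define f where "f = (\<lambda>m. pochhammer a m * pochhammer b m * pochhammer c m / (pochhammer e m * fact m))"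
  define g where "g = (\<lambda>n. pochhammer a' n * pochhammer b' n * pochhammer c' n / (pochhammer e' n * fact n))"
  define h where "h = (\<lambda>k. pochhammer a k * pochhammer (e - b) k * pochhammer (e - c) k / (pochhammer e k * fact k))"
  define u where "u = (\<lambda>n. pochhammer b' n * pochhammer c' n / fact n)"
  define C where "C = Gamma d * Gamma e' * rGamma a'"
  have \<sigma>_eq: "\<sigma> = d + e - b - c" using assms(1,2) by (simp add: \<sigma>_def)
  have s_pos: "Re s > 0" using assms(4) by (simp add: s_def \<sigma>_def)

  have kdf_term: "kampe_de_feriet_term d a b c e a' b' c' e' 1 1 m n =
          Gamma d * (f m * g n * rGamma (d + of_nat (m + n)))" for m n
  proof -
    have "1 / pochhammer d (m + n) = Gamma d * rGamma (d + of_nat (m + n))"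
      using pochhammer_Gamma[OF assms(6), of "m + n"] by (simp add: rGamma_inverse_Gamma field_simps)
    thus ?thesis
      unfolding kampe_de_feriet_term_def f_def g_def by (simp add: divide_inverse mult_ac)
  qed
  have summable1: "(\<lambda>(m, n). f m * g n * rGamma (d + of_nat (m + n))) summable_on UNIV"
    unfolding f_def g_def
    by (rule summable_on_double_rGamma; (rule poly_growth_3F2_coeff)?) (use assms in auto)
  have summable2: "(\<lambda>(k, n). h k * u n * rGamma (\<sigma> + of_nat (k + n))) summable_on UNIV"
  proof (rule summable_on_double_rGamma)
    show "poly_growth (\<lambda>n. h n / fact n) (Re (a + (e - b) + (e - c) - e) - 2)"
      unfolding h_def by (rule poly_growth_3F2_coeff[OF assms(7)])
    show "poly_growth (\<lambda>n. u n / fact n) (Re b' - 1 + (Re c' - 1))"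
      using poly_growth_mult[OF poly_growth_pochhammer[of b'] poly_growth_pochhammer[of c']]
      by (simp add: u_def)
  qed (use assms s_pos in \<open>auto simp: \<sigma>_eq s_def\<close>)

  \<comment> \<open>The relations for \<open>a'\<close> and \<open>e'\<close> make the Gamma factors depending on \<open>n\<close> cancel \<open>(a')\<^sub>n / (e')\<^sub>n\<close>.\<close>
  have inner1: "(\<Sum>\<^sub>\<infinity>m. f m * g n * rGamma (d + of_nat (m + n))) =
          Gamma e' * rGamma a' * (\<Sum>\<^sub>\<infinity>k. h k * u n * rGamma (\<sigma> + of_nat (k + n)))" for n
  proof -
    have "(\<Sum>\<^sub>\<infinity>m. f m * g n * rGamma (d + of_nat (m + n))) =
            (\<Sum>\<^sub>\<infinity>m. g n * (f m * rGamma (d + of_nat n + of_nat m)))"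
      by (intro infsum_cong) (simp add: mult_ac add_ac)
    also have "\<dots> = g n * thomae_sum a b c (d + of_nat n) e"
      unfolding thomae_sum_def f_def by (rule infsum_cmult_right')
    also have "thomae_sum a b c (d + of_nat n) e =
         Gamma (d + of_nat n + e - a - b - c) * rGamma (d + of_nat n - a) *
           thomae_sum a (e - b) (e - c) (d + of_nat n + e - b - c) e"
      by (rule thomae_transformation) (use assms in auto)
    also have "d + of_nat n + e - a - b - c = e' + of_nat n" using assms(2) by simp
    also have "d + of_nat n - a = a' + of_nat n" using assms(1) by simp
    also have "d + of_nat n + e - b - c = \<sigma> + of_nat n" by (simp add: \<sigma>_eq)
    also have "g n * (Gamma (e' + of_nat n) * rGamma (a' + of_nat n) *
                 thomae_sum a (e - b) (e - c) (\<sigma> + of_nat n) e) =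
               Gamma e' * rGamma a' * (u n * thomae_sum a (e - b) (e - c) (\<sigma> + of_nat n) e)"
    proof -
      have "Gamma e' \<noteq> 0" "pochhammer e' n \<noteq> 0"
        using assms(8) pochhammer_eq_0_imp_nonpos_Int[of e' n] by (auto simp: Gamma_eq_zero_iff)
      hence "Gamma (e' + of_nat n) = Gamma e' * pochhammer e' n"
        using pochhammer_Gamma[OF assms(8), of n] by (simp add: field_simps)
      thus ?thesis
        using \<open>pochhammer e' n \<noteq> 0\<close> pochhammer_rGamma[of a' n] by (simp add: g_def u_def)
    qed
    also have "u n * thomae_sum a (e - b) (e - c) (\<sigma> + of_nat n) e =
                 (\<Sum>\<^sub>\<infinity>k. u n * (h k * rGamma (\<sigma> + of_nat n + of_nat k)))"
      unfolding thomae_sum_def h_def by (rule infsum_cmult_right' [symmetric])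
    also have "\<dots> = (\<Sum>\<^sub>\<infinity>k. h k * u n * rGamma (\<sigma> + of_nat (k + n)))"
      by (intro infsum_cong) (simp add: mult_ac add_ac)
    finally show ?thesis .
  qed

  have "kampe_de_feriet d a b c e a' b' c' e' 1 1 =
          (\<Sum>\<^sub>\<infinity>x. Gamma d * (case x of (m, n) \<Rightarrow> f m * g n * rGamma (d + of_nat (m + n))))"
    unfolding kampe_de_feriet_def by (intro infsum_cong) (auto simp: kdf_term)
  also have "\<dots> = Gamma d * (\<Sum>\<^sub>\<infinity>(m, n)\<in>UNIV. f m * g n * rGamma (d + of_nat (m + n)))"
    by (rule infsum_cmult_right')
  also have "(\<Sum>\<^sub>\<infinity>(m, n)\<in>UNIV. f m * g n * rGamma (d + of_nat (m + n))) =
               (\<Sum>\<^sub>\<infinity>m. \<Sum>\<^sub>\<infinity>n. f m * g n * rGamma (d + of_nat (m + n)))"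
    using infsum_Sigma'_banach[where A = UNIV and B = "\<lambda>_. UNIV" and
      f = "\<lambda>m n. f m * g n * rGamma (d + of_nat (m + n))"] summable1 by simp
  also have "\<dots> = (\<Sum>\<^sub>\<infinity>n. \<Sum>\<^sub>\<infinity>m. f m * g n * rGamma (d + of_nat (m + n)))"
    by (rule infsum_swap_banach) (use summable1 in simp)
  also have "\<dots> = Gamma e' * rGamma a' *
               (\<Sum>\<^sub>\<infinity>n. \<Sum>\<^sub>\<infinity>k. h k * u n * rGamma (\<sigma> + of_nat (k + n)))"
    unfolding inner1 by (rule infsum_cmult_right')
  also have "(\<Sum>\<^sub>\<infinity>n. \<Sum>\<^sub>\<infinity>k. h k * u n * rGamma (\<sigma> + of_nat (k + n))) =
             (\<Sum>\<^sub>\<infinity>k. \<Sum>\<^sub>\<infinity>n. h k * u n * rGamma (\<sigma> + of_nat (k + n)))"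
    by (rule infsum_swap_banach [symmetric]) (use summable2 in simp)
  also have "Gamma d * (Gamma e' * rGamma a' * \<dots>) = C * \<dots>"
    by (simp add: C_def)
  finally have kdf: "kampe_de_feriet d a b c e a' b' c' e' 1 1 =
     C * (\<Sum>\<^sub>\<infinity>k. \<Sum>\<^sub>\<infinity>n. h k * u n * rGamma (\<sigma> + of_nat (k + n)))" .

  define P where "P = (\<lambda>k. h k * pochhammer s k / (pochhammer (\<sigma> - b') k * pochhammer (\<sigma> - c') k))"
  define E where "E = Gamma s * rGamma (\<sigma> - b') * rGamma (\<sigma> - c')"
  have nonpos: "s \<notin> \<int>\<^sub>\<le>\<^sub>0" "\<sigma> - b' \<notin> \<int>\<^sub>\<le>\<^sub>0" "\<sigma> - c' \<notin> \<int>\<^sub>\<le>\<^sub>0"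
    using Re_pos_imp_not_nonpos_Int[OF s_pos] assms(9,10) by (simp_all add: \<sigma>_def)
  have inner2: "(\<Sum>\<^sub>\<infinity>n. h k * u n * rGamma (\<sigma> + of_nat (k + n))) = E * P k" for k
  proof -
    have rG: "rGamma (z + of_nat k) = rGamma z / pochhammer z k" if "z \<notin> \<int>\<^sub>\<le>\<^sub>0" for z :: complex
      using pochhammer_rGamma[of z k] pochhammer_eq_0_imp_nonpos_Int[of z k] that by auto
    have "(\<Sum>\<^sub>\<infinity>n. h k * u n * rGamma (\<sigma> + of_nat (k + n))) =
            (\<Sum>\<^sub>\<infinity>n. h k * (u n * rGamma (\<sigma> + of_nat k + of_nat n)))"
      by (intro infsum_cong) (simp add: mult_ac add_ac)
    also have "\<dots> = h k * (\<Sum>\<^sub>\<infinity>n. u n * rGamma (\<sigma> + of_nat k + of_nat n))"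
      by (rule infsum_cmult_right')
    also have "(\<Sum>\<^sub>\<infinity>n. u n * rGamma (\<sigma> + of_nat k + of_nat n)) =
       Gamma (\<sigma> + of_nat k - b' - c') * rGamma (\<sigma> + of_nat k - b') * rGamma (\<sigma> + of_nat k - c')"
      unfolding u_def by (rule gauss_summation) (use s_pos in \<open>simp add: s_def\<close>)
    also have "\<sigma> + of_nat k - b' - c' = s + of_nat k" by (simp add: s_def)
    also have "\<sigma> + of_nat k - b' = \<sigma> - b' + of_nat k" by simp
    also have "\<sigma> + of_nat k - c' = \<sigma> - c' + of_nat k" by simp
    also have "Gamma (s + of_nat k) = Gamma s * pochhammer s k"
      using pochhammer_Gamma[OF nonpos(1), of k] nonpos(1)
      by (simp add: Gamma_eq_zero_iff field_simps)
    finally show ?thesis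
      by (simp add: E_def P_def rG nonpos)
  qed

  have "(\<lambda>k. \<Sum>\<^sub>\<infinity>n. h k * u n * rGamma (\<sigma> + of_nat (k + n))) summable_on UNIV"
    by (rule summable_on_Sigma_banach[where B = "\<lambda>_. UNIV"]) (use summable2 in simp)
  hence "(\<lambda>k. E * P k) summable_on UNIV" by (simp only: inner2)
  hence "((\<lambda>k. E * P k) has_sum (\<Sum>\<^sub>\<infinity>k. E * P k)) UNIV" by (rule has_sum_infsum)
  hence sums: "(\<lambda>k. E * P k) sums (\<Sum>\<^sub>\<infinity>k. E * P k)" by (rule has_sum_imp_sums)
  have E_nz: "E \<noteq> 0"
    using nonpos by (simp add: E_def rGamma_eq_zero_iff Gamma_eq_zero_iff)
  have "pFq [a, e - b, e - c, d + e' - a' - b' - c'] [e, d + e' - a' - b', d + e' - a' - c'] 1 = suminf P"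
    unfolding pFq_altdef P_def h_def s_def \<sigma>_def by (simp add: mult_ac)
  moreover have "(\<Sum>\<^sub>\<infinity>k. E * P k) = E * suminf P"
  proof -
    have "summable P" using sums E_nz by (auto simp: sums_iff summable_cmult_iff)
    from suminf_mult[OF this, of E] sums show ?thesis by (simp add: sums_iff)
  qed
  ultimately show ?thesis
    unfolding kdf inner2
    by (simp add: C_def E_def s_def \<sigma>_def rGamma_inverse_Gamma divide_simps)
qed

end
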